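(* For all states $c\in X$ and $d\in Y$ of finitely branching $F$-coalgebras $(X,\xi)$ and $(Y,\zeta)$, $$d^{\log}_{S^\Lambda}(c,d)=d_\Lambda(c,d).$$
   Context: Let $\mathcal V=[0,1]$, and let $\oplus,\ominus$ be truncated addition and subtraction on $\mathcal V$. Let $F\colon\mathbf{Set}\to\mathbf{Set}$ be a functor. A coalgebra $(X,\xi)$, $\xi\colon X\to FX$, is finitely branching if for every $x$ there are a finite $X_0\subseteq X$ and $a\in FX_0$ with $Fi(a)=\xi(x)$, where $i$ is the inclusion $X_0\hookrightarrow X$. Fix a set $\Lambda$ of monotone $2$-to-$\mathcal V$ predicate liftings, i.e. families $\lambda_X\colon 2^X\to\mathcal V^{FX}$ that are natural ($\lambda_Y(A)(Ff(a))=\lambda_X(f^{-1}[A])(a)$) and monotone in $A$. $\epsilon$-$\Lambda$-simulations: $R\subseteq X\times Y$ such that $xRy$ implies $\lambda_Y(R[A])(\zeta(y))\ge\lambda_X(A)(\xi(x))-\epsilon$ for all $\lambda\in\Lambda$ and $A\subseteq X$. Write $x\preceq_{\epsilon,\Lambda}y$ if some such $R$ relates them, and put $d_\Lambda(x,y)=\bigwedge\{\epsilon\in\mathcal V\mid x\preceq_{\epsilon,\Lambda}y\}$. For $f\colon X\to\mathcal V$ let $f_\epsilon=\{x\mid f(x)\ge\epsilon\}$. The Sugeno modality is $S^\lambda_X(f)(a)=\bigvee_{\epsilon\in\mathcal V}\epsilon\wedge\lambda_X(f_\epsilon)(a)$. Quantitative formulae are given by $$\phi,\psi::=\top\mid\bot\mid\phi\wedge\psi\mid\phi\vee\psi\mid\phi\oplus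 q\mid\phi\ominus q\mid S^\lambda\phi\qquad(q\in\mathcal V,\ \lambda\in\Lambda).$$ They are interpreted over a coalgebra $(X,\xi)$ as maps $[\![\phi]\!]\colon X\to\mathcal V$: - $[\![\top]\!]=1$ and $[\![\bot]\!]=0$; - $\wedge,\vee$ are interpreted as pointwise min and max; - $\oplus q$ and $\ominus q$ are interpreted pointwise; - $[\![S^\lambda\phi]\!](x)=S^\lambda_X([\![\phi]\!])(\xi(x))$. The Sugeno logical distance is $$d^{\log}_{S^\Lambda}(c,d)=\bigvee_{\phi}\big([\![\phi]\!](c)-[\![\phi]\!](d)\big).$$ *)

theory Defs
  imports Complex_Main "HOL-Library.FuncSet"
begin

text \<open>
  The objects of the category of sets are the subsets of an arbitrary type \<open>'u\<close>, and the morphisms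
  from \<open>X\<close> to \<open>Y\<close> are the elements of \<open>X \<rightarrow>\<^sub>E Y\<close>. The sets \<open>F X\<close> live in a second type \<open>'f\<close>, since
  in general (e.g. for the powerset functor) they do not fit into \<open>'u\<close>; \<open>F\<close> is never iterated here.
  The action \<open>Fmap X Y\<close> on morphisms depends on the codomain \<open>Y\<close>, so that a functor need not send
  inclusions to inclusions.
\<close>

locale set_functor =
  fixes F :: "'u set \<Rightarrow> 'f set"
    and Fmap :: "'u set \<Rightarrow> 'u set \<Rightarrow> ('u \<Rightarrow> 'u) \<Rightarrow> 'f \<Rightarrow> 'f"
  assumes Fmap_mem: "f \<in> X \<rightarrow>\<^sub>E Y \<Longrightarrow> a \<in> F X \<Longrightarrow> Fmap X Y f a \<in> F Y"
    and Fmap_id: "a \<in> F X \<Longrightarrow> Fmap X X (\<lambda>x\<in>X. x) a = a"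
    and Fmap_compose: "f \<in> X \<rightarrow>\<^sub>E Y \<Longrightarrow> g \<in> Y \<rightarrow>\<^sub>E Z \<Longrightarrow> a \<in> F X \<Longrightarrow>
      Fmap X Z (compose X g f) a = Fmap Y Z g (Fmap X Y f a)"

definition coalgebra :: "('u set \<Rightarrow> 'f set) \<Rightarrow> 'u set \<Rightarrow> ('u \<Rightarrow> 'f) \<Rightarrow> bool" where
  "coalgebra F X \<xi> \<longleftrightarrow> \<xi> \<in> X \<rightarrow> F X"

definition finitely_branching ::
  "('u set \<Rightarrow> 'f set) \<Rightarrow> ('u set \<Rightarrow> 'u set \<Rightarrow> ('u \<Rightarrow> 'u) \<Rightarrow> 'f \<Rightarrow> 'f) \<Rightarrow> 'u set \<Rightarrow> ('u \<Rightarrow> 'f) \<Rightarrow> bool" where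
  "finitely_branching F Fmap X \<xi> \<longleftrightarrow>
    (\<forall>x\<in>X. \<exists>X0 a. finite X0 \<and> X0 \<subseteq> X \<and> a \<in> F X0 \<and> Fmap X0 X (\<lambda>z\<in>X0. z) a = \<xi> x)"

text \<open>\<open>lam X A a\<close> is the value of the \<open>X\<close>-component at \<open>A \<subseteq> X\<close> and \<open>a \<in> F X\<close>; values at other
  arguments are irrelevant.\<close>

type_synonym ('u, 'f) lifting = "'u set \<Rightarrow> 'u set \<Rightarrow> 'f \<Rightarrow> real"

definition monotone_predicate_lifting ::
  "('u set \<Rightarrow> 'f set) \<Rightarrow> ('u set \<Rightarrow> 'u set \<Rightarrow> ('u \<Rightarrow> 'u) \<Rightarrow> 'f \<Rightarrow> 'f) \<Rightarrow> ('u, 'f) lifting \<Rightarrow> bool" where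
  "monotone_predicate_lifting F Fmap lam \<longleftrightarrow>
    (\<forall>X A a. A \<subseteq> X \<and> a \<in> F X \<longrightarrow> lam X A a \<in> {0..1}) \<and>
    (\<forall>X Y f A a. f \<in> X \<rightarrow>\<^sub>E Y \<and> A \<subseteq> Y \<and> a \<in> F X \<longrightarrow>
      lam Y A (Fmap X Y f a) = lam X (f -` A \<inter> X) a) \<and>
    (\<forall>X A B a. A \<subseteq> B \<and> B \<subseteq> X \<and> a \<in> F X \<longrightarrow> lam X A a \<le> lam X B a)"

definition simulation ::
  "('u, 'f) lifting set \<Rightarrow> real \<Rightarrow> 'u set \<Rightarrow> ('u \<Rightarrow> 'f) \<Rightarrow> 'u set \<Rightarrow> ('u \<Rightarrow> 'f) \<Rightarrow> ('u \<times> 'u) set \<Rightarrow> bool" where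
  "simulation \<Lambda> \<epsilon> X \<xi> Y \<zeta> R \<longleftrightarrow> R \<subseteq> X \<times> Y \<and>
    (\<forall>(x, y)\<in>R. \<forall>lam\<in>\<Lambda>. \<forall>A. A \<subseteq> X \<longrightarrow> lam Y (R `` A) (\<zeta> y) \<ge> lam X A (\<xi> x) - \<epsilon>)"

definition similar ::
  "('u, 'f) lifting set \<Rightarrow> real \<Rightarrow> 'u set \<Rightarrow> ('u \<Rightarrow> 'f) \<Rightarrow> 'u set \<Rightarrow> ('u \<Rightarrow> 'f) \<Rightarrow> 'u \<Rightarrow> 'u \<Rightarrow> bool" where
  "similar \<Lambda> \<epsilon> X \<xi> Y \<zeta> x y \<longleftrightarrow> (\<exists>R. simulation \<Lambda> \<epsilon> X \<xi> Y \<zeta> R \<and> (x, y) \<in> R)"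

text \<open>The set below is bounded, and contains 1 whenever \<open>x \<in> X\<close>, \<open>y \<in> Y\<close> (via \<open>R = X \<times> Y\<close>), so that
  the real infimum is the meet in the unit interval.\<close>

definition sim_dist ::
  "('u, 'f) lifting set \<Rightarrow> 'u set \<Rightarrow> ('u \<Rightarrow> 'f) \<Rightarrow> 'u set \<Rightarrow> ('u \<Rightarrow> 'f) \<Rightarrow> 'u \<Rightarrow> 'u \<Rightarrow> real" where
  "sim_dist \<Lambda> X \<xi> Y \<zeta> x y = Inf {\<epsilon> \<in> {0..1}. similar \<Lambda> \<epsilon> X \<xi> Y \<zeta> x y}"

definition sugeno :: "('u, 'f) lifting \<Rightarrow> 'u set \<Rightarrow> ('u \<Rightarrow> real) \<Rightarrow> 'f \<Rightarrow> real" where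
  "sugeno lam X f a = (SUP \<epsilon>\<in>{0..1}. min \<epsilon> (lam X {x \<in> X. f x \<ge> \<epsilon>} a))"

text \<open>Raw syntax over modality names in \<open>'l\<close> and arbitrary real constants; \<open>formulae \<Lambda>\<close> carves out the
  formulae with constants in the unit interval and modalities from \<open>\<Lambda>\<close>.\<close>

datatype 'l formula =
    Top
  | Bot
  | Conj "'l formula" "'l formula"
  | Disj "'l formula" "'l formula"
  | Plus "'l formula" real
  | Minus "'l formula" real
  | Sugeno 'l "'l formula"

inductive_set formulae :: "'l set \<Rightarrow> 'l formula set" for \<Lambda> :: "'l set" where
  "Top \<in> formulae \<Lambda>"
| "Bot \<in> formulae \<Lambda>"
| "\<phi> \<in> formulae \<Lambda> \<Longrightarrow> \<psi> \<in> formulae \<Lambda> \<Longrightarrow> Conj \<phi> \<psi> \<in> formulae \<Lambda>"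
| "\<phi> \<in> formulae \<Lambda> \<Longrightarrow> \<psi> \<in> formulae \<Lambda> \<Longrightarrow> Disj \<phi> \<psi> \<in> formulae \<Lambda>"
| "\<phi> \<in> formulae \<Lambda> \<Longrightarrow> q \<in> {0..1} \<Longrightarrow> Plus \<phi> q \<in> formulae \<Lambda>"
| "\<phi> \<in> formulae \<Lambda> \<Longrightarrow> q \<in> {0..1} \<Longrightarrow> Minus \<phi> q \<in> formulae \<Lambda>"
| "lam \<in> \<Lambda> \<Longrightarrow> \<phi> \<in> formulae \<Lambda> \<Longrightarrow> Sugeno lam \<phi> \<in> formulae \<Lambda>"

primrec sem :: "'u set \<Rightarrow> ('u \<Rightarrow> 'f) \<Rightarrow> ('u, 'f) lifting formula \<Rightarrow> 'u \<Rightarrow> real" where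
  "sem X \<xi> Top = (\<lambda>x. 1)"
| "sem X \<xi> Bot = (\<lambda>x. 0)"
| "sem X \<xi> (Conj \<phi> \<psi>) = (\<lambda>x. min (sem X \<xi> \<phi> x) (sem X \<xi> \<psi> x))"
| "sem X \<xi> (Disj \<phi> \<psi>) = (\<lambda>x. max (sem X \<xi> \<phi> x) (sem X \<xi> \<psi> x))"
| "sem X \<xi> (Plus \<phi> q) = (\<lambda>x. min 1 (sem X \<xi> \<phi> x + q))"
| "sem X \<xi> (Minus \<phi> q) = (\<lambda>x. max 0 (sem X \<xi> \<phi> x - q))"
| "sem X \<xi> (Sugeno lam \<phi>) = (\<lambda>x. sugeno lam X (sem X \<xi> \<phi>) (\<xi> x))"

text \<open>The difference is taken in the reals. As \<open>Top\<close> contributes 0, truncating it at 0 would not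
  change the supremum.\<close>

definition log_dist ::
  "('u, 'f) lifting set \<Rightarrow> 'u set \<Rightarrow> ('u \<Rightarrow> 'f) \<Rightarrow> 'u set \<Rightarrow> ('u \<Rightarrow> 'f) \<Rightarrow> 'u \<Rightarrow> 'u \<Rightarrow> real" where
  "log_dist \<Lambda> X \<xi> Y \<zeta> c d = (SUP \<phi>\<in>formulae \<Lambda>. sem X \<xi> \<phi> c - sem Y \<zeta> \<phi> d)"

end

theory Submission
  imports Defs
begin

text \<open>
  Formulae are non-expansive along an \<open>\<epsilon>\<close>-simulation because it maps the superlevel set of \<open>\<phi>\<close> at
  \<open>\<delta>\<close> into the one at \<open>\<delta> - \<epsilon>\<close>. Conversely, the relation of having logical distance at
  most \<open>\<epsilon>\<close> is an \<open>\<epsilon>\<close>-simulation: if it violates the condition at \<open>(x, y)\<close> for \<open>\<lambda>\<close> and \<open>A\<close>,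
  finite branching reduces \<open>A\<close> to a finite set and the successors of \<open>y\<close> outside its image to
  finitely many. Each member of \<open>A\<close> is separated from each such successor by a formula, which
  \<open>\<oplus>\<close> and \<open>\<ominus>\<close> shift so that it takes the value \<open>v = \<lambda>(A)(\<xi>(x))\<close> on the former and one
  below \<open>v - \<epsilon>\<close> on the latter. A disjunction of conjunctions \<open>\<psi>\<close> of these then separates
  everything at once, and the Sugeno modality applied to \<open>\<psi>\<close> distinguishes \<open>x\<close> from \<open>y\<close> by more
  than \<open>\<epsilon>\<close>.
\<close>

lemma sugeno_upper:
  assumes "\<delta> \<in> {0..1}"
  shows "min \<delta> (lam X {x \<in> X. f x \<ge> \<delta>} a) \<le> sugeno lam X f a"
  unfolding sugeno_def by (rule cSUP_upper[OF assms]) (auto intro!: bdd_aboveI[of _ 1])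

lemma sugeno_least:
  assumes "\<And>\<delta>. \<delta> \<in> {0..1} \<Longrightarrow> min \<delta> (lam X {x \<in> X. f x \<ge> \<delta>} a) \<le> r"
  shows "sugeno lam X f a \<le> r"
  unfolding sugeno_def by (rule cSUP_least) (use assms in auto)

lemma lifting_bounds:
  assumes "monotone_predicate_lifting F Fmap lam" "A \<subseteq> X" "a \<in> F X"
  shows "0 \<le> lam X A a" "lam X A a \<le> 1"
  using assms unfolding monotone_predicate_lifting_def by auto

lemma lifting_mono:
  assumes "monotone_predicate_lifting F Fmap lam" "A \<subseteq> B" "B \<subseteq> X" "a \<in> F X"
  shows "lam X A a \<le> lam X B a"
  using assms unfolding monotone_predicate_lifting_def by blast

lemma lifting_natural:
  assumes "monotone_predicate_lifting F Fmap lam" "f \<in> X \<rightarrow>\<^sub>E Y" "A \<subseteq> Y" "a \<in> F X"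
  shows "lam Y A (Fmap X Y f a) = lam X (f -` A \<inter> X) a"
  using assms unfolding monotone_predicate_lifting_def by blast

lemma sugeno_bounds:
  assumes "monotone_predicate_lifting F Fmap lam" "a \<in> F X"
  shows "0 \<le> sugeno lam X f a" "sugeno lam X f a \<le> 1"
proof -
  have "0 \<le> lam X {x \<in> X. f x \<ge> 0} a"
    using assms by (intro lifting_bounds) auto
  then show "0 \<le> sugeno lam X f a"
    using sugeno_upper[of 0 lam X f a] by simp
  show "sugeno lam X f a \<le> 1"
    by (rule sugeno_least) auto
qed

lemma sem_bounds:
  assumes "\<And>lam. lam \<in> \<Lambda> \<Longrightarrow> monotone_predicate_lifting F Fmap lam"
    and "coalgebra F X \<xi>" and "\<phi> \<in> formulae \<Lambda>" and "x \<in> X"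
  shows "sem X \<xi> \<phi> x \<in> {0..1}"
  using assms(3,4)
proof (induction arbitrary: x)
  case (7 lam \<phi>)
  then have "\<xi> x \<in> F X"
    using assms(2) unfolding coalgebra_def by auto
  then show ?case
    using sugeno_bounds[OF assms(1)[OF 7(1)]] by auto
qed (auto simp: min_le_iff_disj le_max_iff_disj diff_le_eq intro: add_increasing2)

text \<open>Naturality at the inclusion of \<open>X0\<close>: \<open>A\<close> and
  \<open>A \<inter> X0\<close> have the same preimage under it. The set \<open>X0\<close> depends on
  \<open>x\<close> alone, so it serves all liftings and all \<open>A\<close> at once.\<close>

lemma finitely_branching_support:
  assumes "\<And>lam. lam \<in> \<Lambda> \<Longrightarrow> monotone_predicate_lifting F Fmap lam"
    and "finitely_branching F Fmap X \<xi>" and "x \<in> X"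
  obtains X0 where "finite X0" "X0 \<subseteq> X"
    "\<And>lam A. lam \<in> \<Lambda> \<Longrightarrow> A \<subseteq> X \<Longrightarrow> lam X A (\<xi> x) = lam X (A \<inter> X0) (\<xi> x)"
proof -
  obtain X0 a where X0: "finite X0" "X0 \<subseteq> X" "a \<in> F X0"
    and a: "\<xi> x = Fmap X0 X (\<lambda>z\<in>X0. z) a"
    using assms(2,3) unfolding finitely_branching_def by metis
  have incl: "(\<lambda>z\<in>X0. z) \<in> X0 \<rightarrow>\<^sub>E X"
    using X0(2) by auto
  have "lam X A (\<xi> x) = lam X (A \<inter> X0) (\<xi> x)" if "lam \<in> \<Lambda>" "A \<subseteq> X" for lam A
  proof -
    have nat: "lam X B (\<xi> x) = lam X0 ((\<lambda>z\<in>X0. z) -` B \<inter> X0) a" if "B \<subseteq> X" for B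
      unfolding a by (rule lifting_natural[OF assms(1)[OF \<open>lam \<in> \<Lambda>\<close>] incl that X0(3)])
    have "(\<lambda>z\<in>X0. z) -` A \<inter> X0 = (\<lambda>z\<in>X0. z) -` (A \<inter> X0) \<inter> X0"
      by auto
    then show ?thesis
      using nat[of A] nat[of "A \<inter> X0"] that(2) by (metis le_infI1)
  qed
  with X0 that show thesis
    by blast
qed

text \<open>Induction on \<open>\<phi>\<close>. The propositional connectives are non-expansive, so
  only the modality uses the simulation condition.\<close>

lemma simulation_sem:
  assumes lift: "\<And>lam. lam \<in> \<Lambda> \<Longrightarrow> monotone_predicate_lifting F Fmap lam"
    and Y: "coalgebra F Y \<zeta>"
    and R: "simulation \<Lambda> \<epsilon> X \<xi> Y \<zeta> R" and \<epsilon>: "0 \<le> \<epsilon>"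
    and "\<phi> \<in> formulae \<Lambda>" and "(x, y) \<in> R"
  shows "sem X \<xi> \<phi> x - sem Y \<zeta> \<phi> y \<le> \<epsilon>"
  using assms(5,6)
proof (induction arbitrary: x y)
  case (7 lam \<phi>)
  let ?up = "\<lambda>\<delta>. {x \<in> X. sem X \<xi> \<phi> x \<ge> \<delta>}" and ?vp = "\<lambda>\<delta>. {y \<in> Y. sem Y \<zeta> \<phi> y \<ge> \<delta>}"
  have RXY: "R \<subseteq> X \<times> Y"
    using R unfolding simulation_def by simp
  then have \<zeta>y: "\<zeta> y \<in> F Y"
    using 7 Y unfolding coalgebra_def by auto
  note l = lift[OF 7(1)]
  have "sugeno lam X (sem X \<xi> \<phi>) (\<xi> x) \<le> sugeno lam Y (sem Y \<zeta> \<phi>) (\<zeta> y) + \<epsilon>"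
  proof (rule sugeno_least)
    fix \<delta> :: real
    assume \<delta>: "\<delta> \<in> {0..1}"
    show "min \<delta> (lam X (?up \<delta>) (\<xi> x)) \<le> sugeno lam Y (sem Y \<zeta> \<phi>) (\<zeta> y) + \<epsilon>"
    \<comment> \<open>For \<open>\<delta> < \<epsilon>\<close> the threshold
      \<open>\<delta> - \<epsilon>\<close> is no index of the supremum on the right; in this case
      \<open>\<delta>\<close> itself is a sufficient bound.\<close>
    proof (cases "\<delta> \<le> \<epsilon>")
      case True
      then show ?thesis
        using sugeno_bounds(1)[OF l \<zeta>y, of "sem Y \<zeta> \<phi>"] by auto
    next
      case False
      have "?up \<delta> \<subseteq> X"
        by auto
      then have "lam X (?up \<delta>) (\<xi> x) - \<epsilon> \<le> lam Y (R `` ?up \<delta>) (\<zeta> y)"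
        using R 7(1,4) unfolding simulation_def by blast
      also have "\<dots> \<le> lam Y (?vp (\<delta> - \<epsilon>)) (\<zeta> y)"
        using RXY 7(3) by (intro lifting_mono[OF l _ _ \<zeta>y]) (auto, force)
      finally have "lam X (?up \<delta>) (\<xi> x) \<le> lam Y (?vp (\<delta> - \<epsilon>)) (\<zeta> y) + \<epsilon>"
        by simp
      moreover have "min (\<delta> - \<epsilon>) (lam Y (?vp (\<delta> - \<epsilon>)) (\<zeta> y)) \<le> sugeno lam Y (sem Y \<zeta> \<phi>) (\<zeta> y)"
        using \<delta> \<epsilon> False by (intro sugeno_upper) auto
      ultimately show ?thesis
        by auto
    qed
  qed
  then show ?case
    by simp
qed (use \<epsilon> in \<open>force+\<close>)

text \<open>The shift moves the value at \<open>x\<close> exactly to \<open>v\<close>. Truncation at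
  0 cannot spoil the bound at \<open>y\<close>, because \<open>v - \<epsilon>\<close> is
  positive.\<close>

lemma shift_formula:
  assumes \<phi>: "\<phi> \<in> formulae \<Lambda>" and "sem X \<xi> \<phi> x \<in> {0..1}" and v: "v \<in> {0..1}" and "\<epsilon> < v"
    and sep: "sem X \<xi> \<phi> x - sem Y \<zeta> \<phi> y > \<epsilon>"
  shows "\<exists>\<psi>\<in>formulae \<Lambda>. v \<le> sem X \<xi> \<psi> x \<and> sem Y \<zeta> \<psi> y < v - \<epsilon>"
proof (cases "v \<le> sem X \<xi> \<phi> x")
  case True
  have "Minus \<phi> (sem X \<xi> \<phi> x - v) \<in> formulae \<Lambda>"
    using assms True by (intro formulae.intros) auto
  then show ?thesis
    by (rule bexI[rotated]) (use assms in auto)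
next
  case False
  have "Plus \<phi> (v - sem X \<xi> \<phi> x) \<in> formulae \<Lambda>"
    using assms False by (intro formulae.intros) auto
  then show ?thesis
    by (rule bexI[rotated]) (use assms in auto)
qed

text \<open>For a fixed \<open>a\<close>, conjoin over \<open>B\<close>; then take the disjunction
  over \<open>A\<close>. The bounds on \<open>v\<close> and \<open>w\<close> let \<open>Top\<close>
  and \<open>Bot\<close> settle the empty cases.\<close>

lemma finite_separation:
  assumes "finite A" "finite B" "v \<le> 1" "0 < w"
    and sep: "\<And>a b. a \<in> A \<Longrightarrow> b \<in> B \<Longrightarrow> \<exists>\<phi>\<in>formulae \<Lambda>. v \<le> sem X \<xi> \<phi> a \<and> sem Y \<zeta> \<phi> b < w"
  shows "\<exists>\<psi>\<in>formulae \<Lambda>. (\<forall>a\<in>A. v \<le> sem X \<xi> \<psi> a) \<and> (\<forall>b\<in>B. sem Y \<zeta> \<psi> b < w)"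
proof -
  have one: "\<exists>\<psi>\<in>formulae \<Lambda>. v \<le> sem X \<xi> \<psi> a \<and> (\<forall>b\<in>B. sem Y \<zeta> \<psi> b < w)" if "a \<in> A" for a
    using assms(2) sep[OF that]
  proof (induction B)
    case empty
    show ?case
      by (rule bexI[of _ Top]) (use assms(3) in \<open>auto intro: formulae.intros\<close>)
  next
    case (insert b B)
    obtain \<psi> where "\<psi> \<in> formulae \<Lambda>" "v \<le> sem X \<xi> \<psi> a" "\<forall>b\<in>B. sem Y \<zeta> \<psi> b < w"
      using insert.IH insert.prems by blast
    moreover obtain \<phi> where "\<phi> \<in> formulae \<Lambda>" "v \<le> sem X \<xi> \<phi> a" "sem Y \<zeta> \<phi> b < w"
      using insert.prems by blast
    ultimately show ?case
      by (intro bexI[of _ "Conj \<phi> \<psi>"]) (auto intro: formulae.intros simp: min_less_iff_disj)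
  qed
  from assms(1) one show ?thesis
  proof (induction A)
    case empty
    show ?case
      by (rule bexI[of _ Bot]) (use assms(4) in \<open>auto intro: formulae.intros\<close>)
  next
    case (insert a A)
    obtain \<psi> where "\<psi> \<in> formulae \<Lambda>" "\<forall>a\<in>A. v \<le> sem X \<xi> \<psi> a" "\<forall>b\<in>B. sem Y \<zeta> \<psi> b < w"
      using insert.IH insert.prems by blast
    moreover obtain \<phi> where "\<phi> \<in> formulae \<Lambda>" "v \<le> sem X \<xi> \<phi> a" "\<forall>b\<in>B. sem Y \<zeta> \<phi> b < w"
      using insert.prems by blast
    ultimately show ?case
      by (intro bexI[of _ "Disj \<phi> \<psi>"]) (auto intro: formulae.intros simp: le_max_iff_disj)
  qed
qed

lemma logical_simulation:
  assumes lift: "\<And>lam. lam \<in> \<Lambda> \<Longrightarrow> monotone_predicate_lifting F Fmap lam"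
    and X: "coalgebra F X \<xi>" "finitely_branching F Fmap X \<xi>"
    and Y: "coalgebra F Y \<zeta>" "finitely_branching F Fmap Y \<zeta>"
    and \<epsilon>: "0 \<le> \<epsilon>"
  shows "simulation \<Lambda> \<epsilon> X \<xi> Y \<zeta>
    {(x, y) \<in> X \<times> Y. \<forall>\<phi>\<in>formulae \<Lambda>. sem X \<xi> \<phi> x - sem Y \<zeta> \<phi> y \<le> \<epsilon>}"
    (is "simulation _ _ _ _ _ _ ?R")
proof -
  have "lam X A (\<xi> x) - \<epsilon> \<le> lam Y (?R `` A) (\<zeta> y)"
    if xy: "(x, y) \<in> ?R" and lam: "lam \<in> \<Lambda>" and A: "A \<subseteq> X" for x y lam A
  proof (rule ccontr)
    assume neg: "\<not> ?thesis"
    have x: "x \<in> X" and y: "y \<in> Y"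
      and le: "\<And>\<phi>. \<phi> \<in> formulae \<Lambda> \<Longrightarrow> sem X \<xi> \<phi> x - sem Y \<zeta> \<phi> y \<le> \<epsilon>"
      using xy by auto
    note l = lift[OF lam]
    have \<xi>x: "\<xi> x \<in> F X" and \<zeta>y: "\<zeta> y \<in> F Y"
      using x y X(1) Y(1) unfolding coalgebra_def by auto
    obtain X0 where X0: "finite X0" "X0 \<subseteq> X"
      "\<And>A. A \<subseteq> X \<Longrightarrow> lam X A (\<xi> x) = lam X (A \<inter> X0) (\<xi> x)"
      using finitely_branching_support[of \<Lambda>, OF lift X(2) x] lam by metis
    obtain Y0 where Y0: "finite Y0" "Y0 \<subseteq> Y"
      "\<And>A. A \<subseteq> Y \<Longrightarrow> lam Y A (\<zeta> y) = lam Y (A \<inter> Y0) (\<zeta> y)"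
      using finitely_branching_support[of \<Lambda>, OF lift Y(2) y] lam by metis
    define v where "v = lam X A (\<xi> x)"
    define u where "u = lam Y (?R `` A) (\<zeta> y)"
    have RA: "?R `` A \<subseteq> Y"
      by auto
    have v: "v \<in> {0..1}"
      using lifting_bounds[OF l A \<xi>x] by (simp add: v_def)
    \<comment> \<open>Together these give \<open>\<epsilon> < v\<close>, the positivity required for
      shifting and for separating.\<close>
    have u: "0 \<le> u" "u < v - \<epsilon>"
      using lifting_bounds[OF l RA \<zeta>y] neg by (auto simp: u_def v_def)
    let ?B = "Y0 - ?R `` A"
    have "\<exists>\<psi>\<in>formulae \<Lambda>. (\<forall>a\<in>A \<inter> X0. v \<le> sem X \<xi> \<psi> a) \<and> (\<forall>b\<in>?B. sem Y \<zeta> \<psi> b < v - \<epsilon>)"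
    proof (rule finite_separation)
      fix a b
      assume a: "a \<in> A \<inter> X0" and b: "b \<in> ?B"
      then have aX: "a \<in> X" and "b \<in> Y" "(a, b) \<notin> ?R"
        using A Y0(2) by auto
      then obtain \<phi> where \<phi>: "\<phi> \<in> formulae \<Lambda>" "sem X \<xi> \<phi> a - sem Y \<zeta> \<phi> b > \<epsilon>"
        by force
      show "\<exists>\<phi>\<in>formulae \<Lambda>. v \<le> sem X \<xi> \<phi> a \<and> sem Y \<zeta> \<phi> b < v - \<epsilon>"
        using sem_bounds[OF lift X(1) \<phi>(1) aX] u v \<phi>(2)
        by (intro shift_formula[OF \<phi>(1)]) auto
    qed (use X0(1) Y0(1) v u in auto)
    then obtain \<psi> where \<psi>: "\<psi> \<in> formulae \<Lambda>"
      and \<psi>A: "\<And>a. a \<in> A \<inter> X0 \<Longrightarrow> v \<le> sem X \<xi> \<psi> a"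
      and \<psi>B: "\<And>b. b \<in> ?B \<Longrightarrow> sem Y \<zeta> \<psi> b < v - \<epsilon>"
      by blast
    \<comment> \<open>At threshold \<open>v\<close> the superlevel set of \<open>\<psi>\<close>
      contains \<open>A \<inter> X0\<close>, so this single index already pushes the Sugeno value up
      to \<open>v\<close>.\<close>
    have "v = lam X (A \<inter> X0) (\<xi> x)"
      unfolding v_def by (rule X0(3)[OF A])
    also have "\<dots> \<le> lam X {x \<in> X. sem X \<xi> \<psi> x \<ge> v} (\<xi> x)"
      using A \<psi>A by (intro lifting_mono[OF l _ _ \<xi>x]) auto
    finally have hi: "v \<le> sem X \<xi> (Sugeno lam \<psi>) x"
      using sugeno_upper[OF v, of lam X "sem X \<xi> \<psi>" "\<xi> x"] by simp
    \<comment> \<open>A supremum of terms strictly below \<open>v - \<epsilon>\<close> could still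
      reach it; the maximum of a finite set keeps the gap strict. Including \<open>u\<close> makes
      the set nonempty and bounds the lifting at the image of \<open>A\<close>.\<close>
    define w where "w = Max (insert u (sem Y \<zeta> \<psi> ` ?B))"
    have fin: "finite (insert u (sem Y \<zeta> \<psi> ` ?B))"
      using Y0(1) by simp
    have w: "w < v - \<epsilon>" "u \<le> w" "\<And>b. b \<in> ?B \<Longrightarrow> sem Y \<zeta> \<psi> b \<le> w"
      using fin \<psi>B u(2) by (auto simp: w_def)
    have "sugeno lam Y (sem Y \<zeta> \<psi>) (\<zeta> y) \<le> w"
    proof (rule sugeno_least)
      fix \<delta> :: real
      let ?V = "{y \<in> Y. sem Y \<zeta> \<psi> y \<ge> \<delta>}"
      show "min \<delta> (lam Y ?V (\<zeta> y)) \<le> w"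
      proof (cases "\<delta> \<le> w")
        case False
        have "lam Y ?V (\<zeta> y) = lam Y (?V \<inter> Y0) (\<zeta> y)"
          by (rule Y0(3)) auto
        also have "\<dots> \<le> u"
          unfolding u_def
        proof (rule lifting_mono[OF l _ RA \<zeta>y])
          show "?V \<inter> Y0 \<subseteq> ?R `` A"
            using w(3) False by force
        qed
        finally show ?thesis
          using w(2) by auto
      qed auto
    qed
    then show False
      using le[of "Sugeno lam \<psi>"] \<psi> lam hi w(1) by (auto intro: formulae.intros)
  qed
  then show ?thesis
    unfolding simulation_def by auto
qed

theorem theorem6p10:
  fixes F :: "'u set \<Rightarrow> 'f set"
    and Fmap :: "'u set \<Rightarrow> 'u set \<Rightarrow> ('u \<Rightarrow> 'u) \<Rightarrow> 'f \<Rightarrow> 'f"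
    and \<Lambda> :: "('u, 'f) lifting set"
    and X Y :: "'u set"
    and \<xi> \<zeta> :: "'u \<Rightarrow> 'f"
    and c d :: 'u
  assumes "set_functor F Fmap"
    and "\<And>lam. lam \<in> \<Lambda> \<Longrightarrow> monotone_predicate_lifting F Fmap lam"
    and "coalgebra F X \<xi>" and "finitely_branching F Fmap X \<xi>"
    and "coalgebra F Y \<zeta>" and "finitely_branching F Fmap Y \<zeta>"
    and "c \<in> X" and "d \<in> Y"
  shows "log_dist \<Lambda> X \<xi> Y \<zeta> c d = sim_dist \<Lambda> X \<xi> Y \<zeta> c d"
proof -
  let ?D = "\<lambda>\<phi>. sem X \<xi> \<phi> c - sem Y \<zeta> \<phi> d" and ?L = "log_dist \<Lambda> X \<xi> Y \<zeta> c d"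
  let ?S = "{\<epsilon> \<in> {0..1}. similar \<Lambda> \<epsilon> X \<xi> Y \<zeta> c d}"
  have le1: "?D \<phi> \<le> 1" if "\<phi> \<in> formulae \<Lambda>" for \<phi>
    using sem_bounds[OF assms(2,3) that assms(7)] sem_bounds[OF assms(2,5) that assms(8)] by auto
  have upper: "?D \<phi> \<le> ?L" if "\<phi> \<in> formulae \<Lambda>" for \<phi>
    unfolding log_dist_def using that le1 by (intro cSUP_upper bdd_aboveI[of _ 1]) auto
  have least: "?L \<le> r" if "\<And>\<phi>. \<phi> \<in> formulae \<Lambda> \<Longrightarrow> ?D \<phi> \<le> r" for r
    unfolding log_dist_def using that by (intro cSUP_least) (auto intro: formulae.intros)
  have L: "0 \<le> ?L" "?L \<le> 1"
    using upper[of Top] least[of 1] le1 by (auto intro: formulae.intros)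
  \<comment> \<open>The infimum is attained: at \<open>\<epsilon> = ?L\<close> the logical relation
    is a simulation, and it contains \<open>(c, d)\<close> because \<open>?L\<close> bounds every
    difference.\<close>
  have "similar \<Lambda> ?L X \<xi> Y \<zeta> c d"
    unfolding similar_def using logical_simulation[OF assms(2-6) L(1)] upper assms(7,8) by blast
  then have mem: "?L \<in> ?S"
    using L by simp
  have "?L \<le> \<epsilon>" if "\<epsilon> \<in> ?S" for \<epsilon>
    using that simulation_sem[OF assms(2,5)] unfolding similar_def by (intro least) auto
  then show ?thesis
    unfolding sim_dist_def using mem by (intro antisym cInf_greatest cInf_lower bdd_belowI[of _ 0]) auto
qed

end
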